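(* Let $G$ be a finite group (not necessarily abelian) and let $D\subset G$ be a left difference set with parameters $(v,k,\lambda)$, where $k-\lambda>1$. Suppose that $D^{(-1)}$ is equal to a left translate of $D$, and that every right translate of $D$ is also a left translate of $D$. Let $A(G,D)$ be the array with rows indexed by $D$, columns indexed by $G\setminus D$, and $(x,y)$ entry equal to $x^{-1}y$. Then any row and any column of $A(G,D)$ contain a constant number of common elements, so $A(G,D)$ is a triple array.
   Context: Groups are written multiplicatively. A $k$-subset $D$ of a group $G$ of order $v$ is a left difference set with parameters $(v,k,\lambda)$ if every non-identity element of $G$ can be written in exactly $\lambda$ ways as $x^{-1}y$ with $x,y\in D$. Notation: $D^{(-1)}=\{d^{-1}:d\in D\}$; a left translate of $D$ is a set $gD=\{gd:d\in D\}$ and a right translate is a set $Dg=\{dg:d\in D\}$, with $g\in G$. A triple array is an $r\times c$ array (every cell filled) on a set of symbols such that no symbol occurs more than once in any row or column, and for some constants $\kappa,\lambda_{rr},\lambda_{cc},\lambda_{rc}$: (TA1) each symbol occurs exactly $\kappa$ times; (TA2) any two distinct rows contain exactly $\lambda_{rr}$ common symbols; (TA3) any two distinct columns contain exactly $\lambda_{cc}$ common symbols; (TA4) any row and any column contain exactly $\lambda_{rc}$ common symbols. For $A(G,D)$ the symbol set is $G\setminus\{1\}$. *)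

theory Defs
  imports "HOL-Algebra.Coset"
begin

definition left_difference_set ::
    "('a, 'm) monoid_scheme \<Rightarrow> 'a set \<Rightarrow> nat \<Rightarrow> nat \<Rightarrow> nat \<Rightarrow> bool" where
  "left_difference_set G D v k l \<longleftrightarrow>
     D \<subseteq> carrier G \<and> order G = v \<and> card D = k \<and>
     (\<forall>g \<in> carrier G - {\<one>\<^bsub>G\<^esub>}.
        card {(x, y). x \<in> D \<and> y \<in> D \<and> inv\<^bsub>G\<^esub> x \<otimes>\<^bsub>G\<^esub> y = g} = l)"

text \<open>Left and right translates of a subset are the library's \<open>g <# D\<close> and \<open>D #> g\<close>, which
  are defined for arbitrary subsets, not only for subgroups.\<close>

definition is_left_translate :: "('a, 'm) monoid_scheme \<Rightarrow> 'a set \<Rightarrow> 'a set \<Rightarrow> bool" where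
  "is_left_translate G D E \<longleftrightarrow> (\<exists>g \<in> carrier G. E = g <#\<^bsub>G\<^esub> D)"

definition is_right_translate :: "('a, 'm) monoid_scheme \<Rightarrow> 'a set \<Rightarrow> 'a set \<Rightarrow> bool" where
  "is_right_translate G D E \<longleftrightarrow> (\<exists>g \<in> carrier G. E = D #>\<^bsub>G\<^esub> g)"

text \<open>An array with rows indexed by \<open>R\<close> and columns indexed by \<open>C\<close> is a function
  \<open>A\<close> of which only the values \<open>A x y\<close> with \<open>x \<in> R\<close>, \<open>y \<in> C\<close> are relevant.\<close>

definition row_symbols :: "'c set \<Rightarrow> ('r \<Rightarrow> 'c \<Rightarrow> 's) \<Rightarrow> 'r \<Rightarrow> 's set" where
  "row_symbols C A x = {A x y | y. y \<in> C}"

definition col_symbols :: "'r set \<Rightarrow> ('r \<Rightarrow> 'c \<Rightarrow> 's) \<Rightarrow> 'c \<Rightarrow> 's set" where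
  "col_symbols R A y = {A x y | x. x \<in> R}"

definition triple_array :: "'r set \<Rightarrow> 'c set \<Rightarrow> 's set \<Rightarrow> ('r \<Rightarrow> 'c \<Rightarrow> 's) \<Rightarrow> bool" where
  "triple_array R C S A \<longleftrightarrow>
     finite R \<and> R \<noteq> {} \<and> finite C \<and> C \<noteq> {} \<and>
     (\<forall>x \<in> R. \<forall>y \<in> C. A x y \<in> S) \<and>
     (\<forall>x \<in> R. inj_on (\<lambda>y. A x y) C) \<and>
     (\<forall>y \<in> C. inj_on (\<lambda>x. A x y) R) \<and>
     (\<exists>\<kappa> l_rr l_cc l_rc :: nat.
        (\<forall>s \<in> S. card {(x, y). x \<in> R \<and> y \<in> C \<and> A x y = s} = \<kappa>) \<and>
        (\<forall>x \<in> R. \<forall>x' \<in> R. x \<noteq> x' \<longrightarrow> card (row_symbols C A x \<inter> row_symbols C A x') = l_rr) \<and>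
        (\<forall>y \<in> C. \<forall>y' \<in> C. y \<noteq> y' \<longrightarrow> card (col_symbols R A y \<inter> col_symbols R A y') = l_cc) \<and>
        (\<forall>x \<in> R. \<forall>y \<in> C. card (row_symbols C A x \<inter> col_symbols R A y) = l_rc))"

text \<open>The entries of \<open>A(G,D)\<close>; its rows are indexed by \<open>D\<close> and its columns by
  \<open>carrier G - D\<close>.\<close>

definition quotient_array :: "('a, 'm) monoid_scheme \<Rightarrow> 'a \<Rightarrow> 'a \<Rightarrow> 'a" where
  "quotient_array G x y = inv\<^bsub>G\<^esub> x \<otimes>\<^bsub>G\<^esub> y"

end

(* Row x contains the symbols outside x^-1 D, and column y contains D^-1 y. Since D^-1 is a left
   translate of D, any two distinct left translates of D meet in l elements, as do any two distinct
   right translates; this gives (TA2) and (TA3). By hypothesis D^-1 y is itself a left translate of D.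
   It differs from x^-1 D, because 1 lies in x^-1 D but not in D^-1 y, so the two meet in l elements
   and row x and column y share k - l symbols. *)
theory Submission
  imports Defs
begin

context group
begin

section \<open>Translates of a difference set and their intersections\<close>

lemma l_coset_eq_image: "a <# D = (\<lambda>d. a \<otimes> d) ` D"
  by (auto simp: l_coset_def)

lemma r_coset_eq_image: "D #> a = (\<lambda>d. d \<otimes> a) ` D"
  by (auto simp: r_coset_def)

lemma set_inv_eq_image: "set_inv D = (\<lambda>d. inv d) ` D"
  by (auto simp: SET_INV_def)

lemma card_l_coset:
  assumes "a \<in> carrier G" "D \<subseteq> carrier G"
  shows "card (a <# D) = card D"
  unfolding l_coset_eq_image
  by (rule card_image) (use assms in \<open>auto simp: inj_on_def subset_iff\<close>)

lemma inv_mult_eq_iff: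
  assumes "x \<in> carrier G" "y \<in> carrier G" "z \<in> carrier G"
  shows "inv x \<otimes> y = z \<longleftrightarrow> y = x \<otimes> z"
  using assms inv_solve_left' by auto

lemma card_pairs_inv_mult:
  assumes "A \<subseteq> carrier G" "s \<in> carrier G"
  shows "card {(x, y). x \<in> A \<and> y \<in> carrier G \<and> inv x \<otimes> y = s} = card A"
proof -
  have "(x, y) \<in> {(x, y). x \<in> A \<and> y \<in> carrier G \<and> inv x \<otimes> y = s} \<longleftrightarrow>
      (x, y) \<in> (\<lambda>x. (x, x \<otimes> s)) ` A" for x y
    using assms inv_mult_eq_iff[of x y s] by (auto simp: subset_iff)
  then have "{(x, y). x \<in> A \<and> y \<in> carrier G \<and> inv x \<otimes> y = s} = (\<lambda>x. (x, x \<otimes> s)) ` A"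
    by auto
  then show ?thesis
    by (simp add: card_image inj_on_def)
qed

lemma finite_pairs_inv_mult:
  assumes "finite D"
  shows "finite {(x, y). x \<in> D \<and> y \<in> D \<and> inv x \<otimes> y = g}"
  by (rule finite_subset[of _ "D \<times> D"]) (use assms in auto)

text \<open>A common element of the two translates has the form
  \<open>y \<otimes> a = x \<otimes> b\<close> with \<open>x\<close>, \<open>y\<close> in
  \<open>D\<close>, which says that the quotient of \<open>x\<close> and \<open>y\<close> is the
  fixed element \<open>b \<otimes> inv a\<close>. As \<open>a\<close> and \<open>b\<close> differ,
  this element is not \<open>\<one>\<close>, so the difference set property counts the
  pairs.\<close>

lemma card_Int_r_cosets:
  assumes D: "left_difference_set G D v k l"
    and a: "a \<in> carrier G" and b: "b \<in> carrier G" and "a \<noteq> b"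
  shows "card ((D #> a) \<inter> (D #> b)) = l"
proof -
  have sub: "D \<subseteq> carrier G"
    using D by (simp add: left_difference_set_def)
  define g where "g = b \<otimes> inv a"
  have g: "g \<in> carrier G" "g \<noteq> \<one>"
    using a b \<open>a \<noteq> b\<close> inv_solve_right'[of "\<one>" b a] by (auto simp: g_def)
  let ?P = "{(x, y). x \<in> D \<and> y \<in> D \<and> inv x \<otimes> y = g}"
  have eq: "inv x \<otimes> y = g \<longleftrightarrow> y \<otimes> a = x \<otimes> b" if "x \<in> D" "y \<in> D" for x y
  proof -
    have c: "x \<in> carrier G" "y \<in> carrier G"
      using that sub by auto
    have "inv x \<otimes> y = g \<longleftrightarrow> y = (x \<otimes> b) \<otimes> inv a"
      using c a b g by (simp add: inv_mult_eq_iff g_def m_assoc)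
    also have "\<dots> \<longleftrightarrow> y \<otimes> a = x \<otimes> b"
      using c a b by (metis inv_solve_right m_closed)
    finally show ?thesis .
  qed
  have "bij_betw (\<lambda>(x, y). y \<otimes> a) ?P ((D #> a) \<inter> (D #> b))"
    unfolding bij_betw_def
  proof
    \<comment> \<open>Cancelling \<open>a\<close> recovers \<open>y\<close>; then
      \<open>x \<otimes> b = y \<otimes> a\<close> recovers \<open>x\<close>.\<close>
    show "inj_on (\<lambda>(x, y). y \<otimes> a) ?P"
      using sub a b eq by (auto simp: inj_on_def subset_iff) (metis right_cancel)
    show "(\<lambda>(x, y). y \<otimes> a) ` ?P = (D #> a) \<inter> (D #> b)"
      using eq unfolding r_coset_eq_image by (fastforce simp: image_iff)
  qed
  then have "card ((D #> a) \<inter> (D #> b)) = card ?P"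
    by (simp add: bij_betw_same_card)
  then show ?thesis
    using D g by (simp add: left_difference_set_def)
qed

text \<open>Inversion exchanges left and right translates. Composed with multiplication by
  \<open>t\<close>, it becomes an injection that maps \<open>D\<close> onto itself and right
  translates of \<open>D\<close> onto left translates of \<open>D\<close>, so the count for right
  translates carries over.\<close>

lemma card_Int_l_cosets:
  assumes D: "left_difference_set G D v k l"
    and t: "t \<in> carrier G" "set_inv D = t <# D"
    and a: "a \<in> carrier G" and b: "b \<in> carrier G" and "a \<noteq> b"
  shows "card ((a <# D) \<inter> (b <# D)) = l"
proof -
  have sub: "D \<subseteq> carrier G"
    using D by (simp add: left_difference_set_def)
  \<comment> \<open>This is the equation \<open>set_inv D = t <# D\<close> with both sides
    inverted.\<close>
  have inv_D: "(\<lambda>d. inv d \<otimes> inv t) ` D = D"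
  proof -
    have "(\<lambda>d. inv d \<otimes> inv t) ` D = (\<lambda>d. inv d) ` (t <# D)"
      unfolding l_coset_eq_image image_image
      by (rule image_cong) (use sub t in \<open>auto simp: inv_mult_group subset_iff\<close>)
    also have "\<dots> = (\<lambda>d. inv d) ` (\<lambda>d. inv d) ` D"
      by (simp add: t(2)[symmetric] set_inv_eq_image)
    also have "\<dots> = D"
      using sub by (force simp: image_image subset_iff)
    finally show ?thesis .
  qed
  \<comment> \<open>The inverse of \<open>t \<otimes> d \<otimes> inv c\<close> is
    \<open>c \<otimes> inv d \<otimes> inv t\<close>, and \<open>inv d \<otimes> inv t\<close> runs
    over \<open>D\<close> by \<open>inv_D\<close>.\<close>
  have eq: "c <# D = (\<lambda>d. inv (t \<otimes> d)) ` (D #> inv c)" if c: "c \<in> carrier G" for c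
  proof -
    have "c <# D = (\<lambda>d. c \<otimes> d) ` (\<lambda>d. inv d \<otimes> inv t) ` D"
      by (simp add: inv_D l_coset_eq_image)
    also have "\<dots> = (\<lambda>d. inv (t \<otimes> d)) ` (D #> inv c)"
      unfolding r_coset_eq_image image_image
      by (rule image_cong) (use sub t c in \<open>auto simp: inv_mult_group subset_iff m_assoc\<close>)
    finally show ?thesis .
  qed
  have inj: "inj_on (\<lambda>d. inv (t \<otimes> d)) (carrier G)"
    using t by (auto simp: inj_on_def dest: inj_onD[OF inv_inj])
  have "(a <# D) \<inter> (b <# D) = (\<lambda>d. inv (t \<otimes> d)) ` ((D #> inv a) \<inter> (D #> inv b))"
    unfolding eq[OF a] eq[OF b]
    by (rule inj_on_image_Int[OF inj, symmetric]) (use sub a b r_coset_subset_G in auto)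
  also have "card \<dots> = card ((D #> inv a) \<inter> (D #> inv b))"
    by (rule card_image, rule inj_on_subset[OF inj]) (use sub a r_coset_subset_G in blast)
  also have "\<dots> = l"
    by (rule card_Int_r_cosets[OF D]) (use a b \<open>a \<noteq> b\<close> in \<open>auto dest: inj_onD[OF inv_inj]\<close>)
  finally show ?thesis .
qed

section \<open>Symbols in the rows and columns of the array\<close>

lemma row_symbols_quotient_array:
  assumes "D \<subseteq> carrier G" "x \<in> carrier G"
  shows "row_symbols (carrier G - D) (quotient_array G) x = carrier G - (inv x <# D)"
proof
  show "row_symbols (carrier G - D) (quotient_array G) x \<subseteq> carrier G - (inv x <# D)"
    using assms unfolding row_symbols_def quotient_array_def l_coset_eq_image
    by (auto simp: subset_iff)
next
  have "z \<in> row_symbols (carrier G - D) (quotient_array G) x"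
    if "z \<in> carrier G" "z \<notin> inv x <# D" for z
  proof -
    \<comment> \<open>The only column that can show \<open>z\<close> in row \<open>x\<close> is
      \<open>x \<otimes> z\<close>; it lies outside \<open>D\<close> because \<open>z\<close> lies
      outside the translate.\<close>
    have z: "z = inv x \<otimes> (x \<otimes> z)"
      using that assms by (simp add: m_assoc[symmetric])
    then have "x \<otimes> z \<notin> D"
      using that(2) by (auto simp: l_coset_eq_image)
    then show ?thesis
      using that(1) assms(2) z unfolding row_symbols_def quotient_array_def by blast
  qed
  then show "carrier G - (inv x <# D) \<subseteq> row_symbols (carrier G - D) (quotient_array G) x"
    by auto
qed

lemma col_symbols_quotient_array: "col_symbols D (quotient_array G) y = set_inv D #> y"
  unfolding col_symbols_def quotient_array_def r_coset_eq_image set_inv_eq_image by auto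

text \<open>This is (TA1). With \<open>y\<close> ranging over the whole group there is one pair for
  each \<open>x\<close> in \<open>D\<close>, hence \<open>k\<close> pairs; \<open>l\<close> of them
  have \<open>y\<close> in \<open>D\<close>.\<close>

lemma card_pairs_inv_mult_compl:
  assumes fin: "finite (carrier G)" and D: "left_difference_set G D v k l"
    and s: "s \<in> carrier G" "s \<noteq> \<one>"
  shows "card {(x, y). x \<in> D \<and> y \<in> carrier G - D \<and> inv x \<otimes> y = s} = k - l"
proof -
  have sub: "D \<subseteq> carrier G" and k: "card D = k"
    using D by (auto simp: left_difference_set_def)
  have finD: "finite D"
    using sub fin by (rule finite_subset)
  let ?A = "{(x, y). x \<in> D \<and> y \<in> carrier G \<and> inv x \<otimes> y = s}"
  let ?P = "{(x, y). x \<in> D \<and> y \<in> D \<and> inv x \<otimes> y = s}"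
  have "card ?A = k"
    using card_pairs_inv_mult[OF sub s(1)] k by simp
  moreover have "card ?P = l"
    using D s by (simp add: left_difference_set_def)
  moreover have "{(x, y). x \<in> D \<and> y \<in> carrier G - D \<and> inv x \<otimes> y = s} = ?A - ?P"
    by auto
  moreover have "?P \<subseteq> ?A"
    using sub by auto
  ultimately show ?thesis
    using finite_pairs_inv_mult[OF finD] by (simp add: card_Diff_subset)
qed

text \<open>Ensures that the array has at least one row and one column. If \<open>D\<close> were the
  whole group, each of the \<open>k\<close> choices of \<open>x\<close> would represent a given
  \<open>s\<close> exactly once, forcing \<open>l = k\<close>.\<close>

lemma left_difference_set_proper:
  assumes D: "left_difference_set G D v k l" and "1 < int k - int l"
  shows "D \<noteq> {}" "D \<noteq> carrier G"
proof -
  have sub: "D \<subseteq> carrier G" and k: "card D = k"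
    using D by (auto simp: left_difference_set_def)
  show "D \<noteq> {}"
    using k assms(2) by auto
  show "D \<noteq> carrier G"
  proof
    assume DG: "D = carrier G"
    have "\<not> carrier G \<subseteq> {\<one>}"
      using card_mono[of "{\<one>}" "carrier G"] k assms(2) DG by auto
    then obtain s where s: "s \<in> carrier G" "s \<noteq> \<one>"
      by auto
    have "l = k"
      using D s card_pairs_inv_mult[OF sub s(1)] DG by (simp add: left_difference_set_def)
    then show False
      using assms(2) by simp
  qed
qed

lemma card_row_col_symbols:
  assumes fin: "finite (carrier G)" and D: "left_difference_set G D v k l"
    and t: "t \<in> carrier G" "set_inv D = t <# D"
    and right: "\<And>E. is_right_translate G D E \<Longrightarrow> is_left_translate G D E"
    and x: "x \<in> D" and y: "y \<in> carrier G - D"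
  shows "card (row_symbols (carrier G - D) (quotient_array G) x \<inter>
           col_symbols D (quotient_array G) y) = k - l"
proof -
  have sub: "D \<subseteq> carrier G" and k: "card D = k"
    using D by (auto simp: left_difference_set_def)
  have xc: "x \<in> carrier G" and yc: "y \<in> carrier G"
    using x y sub by auto
  have "is_left_translate G D (D #> y)"
    by (rule right) (use yc in \<open>auto simp: is_right_translate_def\<close>)
  then obtain h where h: "h \<in> carrier G" "D #> y = h <# D"
    by (auto simp: is_left_translate_def)
  have th: "t \<otimes> h \<in> carrier G"
    using t h by simp
  \<comment> \<open>The column set is \<open>set_inv D #> y\<close>, that is
    \<open>t <# (D #> y)\<close>, and \<open>D #> y\<close> is \<open>h <# D\<close>.\<close>
  have col: "col_symbols D (quotient_array G) y = (t \<otimes> h) <# D"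
    using t h sub yc coset_assoc[of t y D]
    by (simp add: col_symbols_quotient_array lcos_m_assoc)
  have "\<one> \<in> inv x <# D"
    using x xc by (force simp: l_coset_eq_image)
  \<comment> \<open>An entry \<open>\<one>\<close> in column \<open>y\<close> would put
    \<open>y\<close> itself in \<open>D\<close>.\<close>
  moreover have "\<one> \<notin> (t \<otimes> h) <# D"
  proof
    assume "\<one> \<in> (t \<otimes> h) <# D"
    then obtain d where "d \<in> D" "inv d \<otimes> y = \<one>"
      unfolding col[symmetric] col_symbols_def quotient_array_def by auto
    then show False
      using y sub by (auto simp: inv_mult_eq_iff subset_iff)
  qed
  ultimately have "inv x \<noteq> t \<otimes> h"
    by auto
  then have meet: "card ((inv x <# D) \<inter> ((t \<otimes> h) <# D)) = l"
    by (intro card_Int_l_cosets[OF D t]) (use xc th in auto)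
  have cosets: "(t \<otimes> h) <# D \<subseteq> carrier G"
    using sub th by (rule l_coset_subset_G)
  then have "finite ((t \<otimes> h) <# D)"
    using fin by (rule finite_subset)
  \<comment> \<open>A row is the complement of a translate, so the shared symbols are the column
    minus its overlap with that translate.\<close>
  moreover have "row_symbols (carrier G - D) (quotient_array G) x \<inter> ((t \<otimes> h) <# D)
      = ((t \<otimes> h) <# D) - ((inv x <# D) \<inter> ((t \<otimes> h) <# D))"
    using cosets sub xc by (auto simp: row_symbols_quotient_array)
  ultimately show ?thesis
    using meet th sub k by (simp add: col card_Diff_subset card_l_coset)
qed

text \<open>Both rows are complements of left translates of size \<open>k\<close> that meet in
  \<open>l\<close> elements; inclusion-exclusion gives the size of the union, and neither
  subtraction is truncated.\<close>

lemma card_row_row_symbols: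
  assumes fin: "finite (carrier G)" and D: "left_difference_set G D v k l"
    and t: "t \<in> carrier G" "set_inv D = t <# D"
    and x: "x \<in> D" "x' \<in> D" "x \<noteq> x'"
  shows "card (row_symbols (carrier G - D) (quotient_array G) x \<inter>
           row_symbols (carrier G - D) (quotient_array G) x') = v - (2 * k - l)"
proof -
  have sub: "D \<subseteq> carrier G" and k: "card D = k" and v: "card (carrier G) = v"
    using D by (auto simp: left_difference_set_def order_def)
  have xc: "x \<in> carrier G" "x' \<in> carrier G"
    using x sub by auto
  let ?A = "inv x <# D" and ?B = "inv x' <# D"
  have AB: "?A \<subseteq> carrier G" "?B \<subseteq> carrier G"
    using xc sub by (simp_all add: l_coset_subset_G)
  then have finAB: "finite ?A" "finite ?B"
    using fin by (auto intro: finite_subset)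
  have "card (?A \<inter> ?B) = l"
    by (rule card_Int_l_cosets[OF D t]) (use xc x in \<open>auto dest: inj_onD[OF inv_inj]\<close>)
  then have "card (?A \<union> ?B) = 2 * k - l"
    using card_Un_Int[OF finAB] xc sub k by (simp add: card_l_coset)
  moreover have "row_symbols (carrier G - D) (quotient_array G) x \<inter>
      row_symbols (carrier G - D) (quotient_array G) x' = carrier G - (?A \<union> ?B)"
    using xc sub by (auto simp: row_symbols_quotient_array)
  ultimately show ?thesis
    using AB finAB v by (simp add: card_Diff_subset)
qed

text \<open>Each column is a right translate of \<open>D\<close> multiplied on the left by
  \<open>t\<close>, an injective map, so only the right translates need to be intersected.\<close>

lemma card_col_col_symbols:
  assumes D: "left_difference_set G D v k l"
    and t: "t \<in> carrier G" "set_inv D = t <# D"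
    and y: "y \<in> carrier G" "y' \<in> carrier G" "y \<noteq> y'"
  shows "card (col_symbols D (quotient_array G) y \<inter> col_symbols D (quotient_array G) y') = l"
proof -
  have sub: "D \<subseteq> carrier G"
    using D by (simp add: left_difference_set_def)
  have inj: "inj_on (\<lambda>d. t \<otimes> d) (carrier G)"
    using t by (auto simp: inj_on_def)
  have cosets: "D #> y \<subseteq> carrier G" "D #> y' \<subseteq> carrier G"
    using sub y by (simp_all add: r_coset_subset_G)
  have "col_symbols D (quotient_array G) y \<inter> col_symbols D (quotient_array G) y'
      = t <# ((D #> y) \<inter> (D #> y'))"
    using t y sub inj_on_image_Int[OF inj cosets] coset_assoc[of t _ D]
    by (simp add: col_symbols_quotient_array l_coset_eq_image)
  also have "card \<dots> = card ((D #> y) \<inter> (D #> y'))"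
    by (rule card_l_coset) (use t cosets in auto)
  also have "\<dots> = l"
    using card_Int_r_cosets[OF D y] .
  finally show ?thesis .
qed

end

theorem mainTheorem5:
  fixes G :: "('a, 'm) monoid_scheme" and D :: "'a set" and v k l :: nat
  assumes "group G"
    and "finite (carrier G)"
    and "left_difference_set G D v k l"
    and "int k - int l > 1"
    and "is_left_translate G D (set_inv\<^bsub>G\<^esub> D)"
    and "\<And>E. is_right_translate G D E \<Longrightarrow> is_left_translate G D E"
  shows "(\<exists>m :: nat. \<forall>x \<in> D. \<forall>y \<in> carrier G - D.
            card (row_symbols (carrier G - D) (quotient_array G) x \<inter>
                  col_symbols D (quotient_array G) y) = m) \<and>
         triple_array D (carrier G - D) (carrier G - {\<one>\<^bsub>G\<^esub>}) (quotient_array G)"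
proof -
  interpret group G by fact
  have sub: "D \<subseteq> carrier G"
    using assms(3) by (simp add: left_difference_set_def)
  obtain t where t: "t \<in> carrier G" "set_inv\<^bsub>G\<^esub> D = t <#\<^bsub>G\<^esub> D"
    using assms(5) by (auto simp: is_left_translate_def)
  note row_col = card_row_col_symbols[OF assms(2,3) t assms(6)]
  have "triple_array D (carrier G - D) (carrier G - {\<one>\<^bsub>G\<^esub>}) (quotient_array G)"
    unfolding triple_array_def
  \<comment> \<open>The existential constants stay schematic and are fixed by unification:
    \<open>k - l\<close> for (TA1), \<open>v - (2 * k - l)\<close> for (TA2), \<open>l\<close> for
    (TA3) and \<open>k - l\<close> for (TA4).\<close>
  proof (intro conjI ballI exI impI)
    show "finite D"
      using sub assms(2) by (rule finite_subset)
    show "finite (carrier G - D)"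
      using assms(2) by simp
    show "D \<noteq> {}" "carrier G - D \<noteq> {}"
      using left_difference_set_proper[OF assms(3,4)] sub by auto
    show "quotient_array G x y \<in> carrier G - {\<one>\<^bsub>G\<^esub>}" if "x \<in> D" "y \<in> carrier G - D" for x y
      using that sub by (auto simp: quotient_array_def inv_mult_eq_iff subset_iff)
    show "inj_on (quotient_array G x) (carrier G - D)" if "x \<in> D" for x
      using that sub by (auto simp: quotient_array_def inj_on_def subset_iff)
    show "inj_on (\<lambda>x. quotient_array G x y) D" if "y \<in> carrier G - D" for y
      using that sub by (auto simp: quotient_array_def inj_on_def subset_iff dest: inj_onD[OF inv_inj])
    show "card {(x, y). x \<in> D \<and> y \<in> carrier G - D \<and> quotient_array G x y = s} = k - l"
      if "s \<in> carrier G - {\<one>\<^bsub>G\<^esub>}" for s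
      using card_pairs_inv_mult_compl[OF assms(2,3)] that by (simp add: quotient_array_def)
  qed (use row_col card_row_row_symbols[OF assms(2,3) t] card_col_col_symbols[OF assms(3) t]
       in auto)
  then show ?thesis
    using row_col by blast
qed

end
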